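(* For every even integer $k \geq 4$, every odd integer $u \geq 3$ and every positive integer $g \equiv 0 \pmod k$, there exists a $k$-ARCS of $(K_u \times K_g)(2)$.
   Context: For graphs $G,H$, the tensor product $G \times H$ has vertex set $V(G)\times V(H)$, with $(g_1,h_1)$ adjacent to $(g_2,h_2)$ iff $g_1g_2 \in E(G)$ and $h_1h_2 \in E(H)$. For a graph $G$ and positive integer $\lambda$, $G(\lambda)$ is the multigraph obtained by replacing each edge of $G$ by $\lambda$ parallel edges. $K_n$ is the complete graph on $n$ vertices. $(K_u \times K_g)(\lambda)$ is regarded as a $u$-partite multigraph with partite sets $V_i = \{i\}\times V(K_g)$, $i=1,\dots,u$. A partial $C_k$-factor of $(K_u \times K_g)(\lambda)$ is a subgraph which, for some $i$, is a spanning subgraph of $(K_u \times K_g)(\lambda)\setminus V_i$ all of whose components are cycles of length $k$. A $k$-ARCS of $(K_u \times K_g)(\lambda)$ is a partition of its edge multiset into partial $C_k$-factors. *)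

theory Defs
  imports "HOL-Library.Multiset" "HOL-Number_Theory.Cong"
begin

text \<open>An undirected edge is the set of its endpoints. Simple graphs carry a set of edges,
  multigraphs a multiset of edges.\<close>

record 'a graph =
  gverts :: "'a set"
  gedges :: "'a set set"

record 'a mgraph =
  mverts :: "'a set"
  medges :: "'a set multiset"

definition complete_graph :: "nat \<Rightarrow> nat graph" where
  "complete_graph n =
     \<lparr>gverts = {1..n}, gedges = {{x, y} | x y. x \<in> {1..n} \<and> y \<in> {1..n} \<and> x \<noteq> y}\<rparr>"

definition tensor_product :: "'a graph \<Rightarrow> 'b graph \<Rightarrow> ('a \<times> 'b) graph" where
  "tensor_product G H =
     \<lparr>gverts = gverts G \<times> gverts H,
      gedges = {{(g1, h1), (g2, h2)} | g1 h1 g2 h2. {g1, g2} \<in> gedges G \<and> {h1, h2} \<in> gedges H}\<rparr>"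

text \<open>The multigraph \<open>G(\<lambda>)\<close>. Only meaningful for finite \<open>G\<close>, since \<^const>\<open>mset_set\<close>
  sends infinite sets to the empty multiset.\<close>

definition multiply_edges :: "nat \<Rightarrow> 'a graph \<Rightarrow> 'a mgraph" where
  "multiply_edges l G = \<lparr>mverts = gverts G, medges = repeat_mset l (mset_set (gedges G))\<rparr>"

definition delete_verts :: "'a mgraph \<Rightarrow> 'a set \<Rightarrow> 'a mgraph" where
  "delete_verts G S = \<lparr>mverts = mverts G - S, medges = {#e \<in># medges G. e \<inter> S = {}#}\<rparr>"

definition subgraph :: "'a mgraph \<Rightarrow> 'a mgraph \<Rightarrow> bool" where
  "subgraph H G \<longleftrightarrow> mverts H \<subseteq> mverts G \<and> medges H \<subseteq># medges G \<and>
     (\<forall>e \<in># medges H. e \<subseteq> mverts H)"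

definition spanning_subgraph :: "'a mgraph \<Rightarrow> 'a mgraph \<Rightarrow> bool" where
  "spanning_subgraph H G \<longleftrightarrow> subgraph H G \<and> mverts H = mverts G"

definition induced_subgraph :: "'a mgraph \<Rightarrow> 'a set \<Rightarrow> 'a mgraph" where
  "induced_subgraph G S = \<lparr>mverts = S, medges = {#e \<in># medges G. e \<subseteq> S#}\<rparr>"

definition adjacent :: "'a mgraph \<Rightarrow> 'a \<Rightarrow> 'a \<Rightarrow> bool" where
  "adjacent G x y \<longleftrightarrow> {x, y} \<in># medges G"

definition components :: "'a mgraph \<Rightarrow> 'a mgraph set" where
  "components G =
     {induced_subgraph G {y \<in> mverts G. (adjacent G)\<^sup>*\<^sup>* x y} | x. x \<in> mverts G}"

definition is_cycle :: "nat \<Rightarrow> 'a mgraph \<Rightarrow> bool" where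
  "is_cycle k G \<longleftrightarrow> k \<ge> 3 \<and>
     (\<exists>vs. distinct vs \<and> length vs = k \<and> mverts G = set vs \<and>
        medges G = {#{vs ! i, vs ! (Suc i mod k)}. i \<in># mset_set {..<k}#})"

definition tensor_multigraph :: "nat \<Rightarrow> nat \<Rightarrow> nat \<Rightarrow> (nat \<times> nat) mgraph" where
  "tensor_multigraph u g l =
     multiply_edges l (tensor_product (complete_graph u) (complete_graph g))"

definition partite_set :: "nat \<Rightarrow> nat \<Rightarrow> (nat \<times> nat) set" where
  "partite_set g i = {i} \<times> gverts (complete_graph g)"

definition partial_cycle_factor ::
    "nat \<Rightarrow> nat \<Rightarrow> nat \<Rightarrow> nat \<Rightarrow> (nat \<times> nat) mgraph \<Rightarrow> bool" where
  "partial_cycle_factor k u g l F \<longleftrightarrow>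
     (\<exists>i \<in> {1..u}.
        spanning_subgraph F (delete_verts (tensor_multigraph u g l) (partite_set g i)) \<and>
        (\<forall>C \<in> components F. is_cycle k C))"

text \<open>The factors form a multiset because, with parallel edges, two factors of a partition may
  coincide as graphs.\<close>

definition is_ARCS ::
    "nat \<Rightarrow> nat \<Rightarrow> nat \<Rightarrow> nat \<Rightarrow> (nat \<times> nat) mgraph multiset \<Rightarrow> bool" where
  "is_ARCS k u g l D \<longleftrightarrow>
     (\<forall>F \<in># D. partial_cycle_factor k u g l F) \<and>
     (\<Sum>F \<in># D. medges F) = medges (tensor_multigraph u g l)"

end

theory Submission
  imports Defs
begin

text \<open>
  For odd \<open>u\<close> the pairs with \<open>a + b = 2 * i\<close> modulo \<open>u\<close> form a near-one-factor of \<open>K\<^sub>u\<close> missing \<open>i\<close>,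
  and every edge lies in exactly one of these. It therefore suffices to split
  \<open>(K\<^sub>2 \<times> K\<^sub>g)(2)\<close> into \<open>g - 1\<close> spanning unions of \<open>k\<close>-cycles. Perfect matchings of
  \<open>K\<^sub>2 \<times> K\<^sub>g\<close> are derangements of the \<open>g\<close> points; two derangements \<open>\<sigma>\<close>, \<open>\<tau>\<close> form a union of
  \<open>k\<close>-cycles iff all orbits of \<open>\<tau>\<^sup>-\<^sup>1 \<circ> \<sigma>\<close> have length \<open>m = k div 2\<close>. So one looks for a one-factorisation
  \<open>\<rho>\<close> of \<open>K\<^sub>2 \<times> K\<^sub>g\<close>, indexed by \<open>J\<close>, and a permutation \<open>\<pi>\<close> of \<open>J\<close> such that each
  \<open>\<rho> j\<close>, \<open>\<rho> (\<pi> j)\<close> is such a pair: every matching is then used exactly twice.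

  Cut the points into \<open>t = g div k\<close> blocks of size \<open>k\<close>. Between different blocks use the shifts by
  \<open>c\<close> modulo \<open>k\<close>, with \<open>\<pi> c = c + 2\<close>. Inside the blocks use the standard one-factorisation of
  \<open>K\<^sub>k\<close> on the integers modulo \<open>k - 1\<close> and infinity, that is the reflections \<open>x \<mapsto> 2 * h - x\<close>
  exchanging \<open>h\<close> with infinity, and \<open>\<pi> h = h + m\<close>; consecutive factors form a Hamiltonian cycle
  of \<open>K\<^sub>k\<close>, which lifts to two \<open>k\<close>-cycles.
\<close>

section \<open>Components that are cycles\<close>

text \<open>Same shape as the edge multiset in \<open>is_cycle\<close>, with the modulus read off
  the list.\<close>

definition cycle_edges :: "'a list \<Rightarrow> 'a set multiset" where
  "cycle_edges vs = {#{vs ! i, vs ! (Suc i mod length vs)}. i \<in># mset_set {..<length vs}#}"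

lemma cycle_edges_subset:
  assumes "e \<in># cycle_edges vs"
  shows "e \<subseteq> set vs"
proof -
  obtain i where i: "i < length vs" and e: "e = {vs ! i, vs ! (Suc i mod length vs)}"
    using assms by (auto simp: cycle_edges_def)
  have "Suc i mod length vs < length vs" using i by (intro mod_less_divisor) auto
  with i e show ?thesis by auto
qed

text \<open>No edge leaves \<open>set vs\<close>, because every edge meeting it is an edge of the
  cycle; conversely, walking along the list reaches all of \<open>set vs\<close>. So the component
  of \<open>v\<close> is exactly the cycle. An empty edge would lie inside \<open>set vs\<close>
  without meeting it, hence its exclusion.\<close>

lemma is_cycle_component:
  assumes k: "3 \<le> length vs" and dist: "distinct vs" and sub: "set vs \<subseteq> mverts F"
    and v: "v \<in> set vs" and ne: "{} \<notin># medges F"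
    and edges: "{#e \<in># medges F. e \<inter> set vs \<noteq> {}#} = cycle_edges vs"
  shows "is_cycle (length vs) (induced_subgraph F {y \<in> mverts F. (adjacent F)\<^sup>*\<^sup>* v y})"
proof -
  let ?k = "length vs"
  have incident: "e \<subseteq> set vs \<longleftrightarrow> e \<inter> set vs \<noteq> {}" if "e \<in># medges F" for e
  proof
    assume "e \<inter> set vs \<noteq> {}"
    then have "e \<in># cycle_edges vs" using that by (simp flip: edges)
    then show "e \<subseteq> set vs" by (rule cycle_edges_subset)
  qed (use that ne in \<open>auto simp: Int_absorb2\<close>)
  obtain p where p: "p < ?k" "v = vs ! p" using v by (auto simp: in_set_conv_nth)
  have step: "adjacent F (vs ! i) (vs ! (Suc i mod ?k))" if "i < ?k" for i
  proof -
    have "{vs ! i, vs ! (Suc i mod ?k)} \<in># cycle_edges vs"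
      using that by (auto simp: cycle_edges_def)
    then show ?thesis by (simp flip: edges add: adjacent_def)
  qed
  have reach: "(adjacent F)\<^sup>*\<^sup>* v (vs ! ((p + n) mod ?k))" for n
  proof (induction n)
    case 0
    then show ?case using p by simp
  next
    case (Suc n)
    have "(p + n) mod ?k < ?k" using k by (intro mod_less_divisor) auto
    from step[OF this] have "adjacent F (vs ! ((p + n) mod ?k)) (vs ! ((p + Suc n) mod ?k))"
      by (simp add: mod_Suc_eq)
    with Suc show ?case by (rule rtranclp.rtrancl_into_rtrancl)
  qed
  have "(adjacent F)\<^sup>*\<^sup>* v y" if y: "y \<in> set vs" for y
  proof -
    obtain q where q: "q < ?k" "y = vs ! q" using y by (auto simp: in_set_conv_nth)
    \<comment> \<open>Adding \<open>?k\<close> before subtracting \<open>p\<close> keeps the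
      subtraction exact in the naturals: the walk from \<open>p\<close> to \<open>q\<close> goes
      forward, past the end of the list if necessary.\<close>
    have "(p + (q + ?k - p)) mod ?k = q" using p q by simp
    with reach[of "q + ?k - p"] q show ?thesis by simp
  qed
  moreover have "y \<in> set vs" if "(adjacent F)\<^sup>*\<^sup>* v y" for y
    using that
  proof induction
    case (step y y')
    then have "{y, y'} \<in># medges F" "{y, y'} \<inter> set vs \<noteq> {}" by (auto simp: adjacent_def)
    with incident show ?case by blast
  qed (rule v)
  ultimately have reachable: "{y \<in> mverts F. (adjacent F)\<^sup>*\<^sup>* v y} = set vs"
    using sub by blast
  have "{#e \<in># medges F. e \<subseteq> set vs#} = cycle_edges vs"
    unfolding edges[symmetric] by (rule filter_mset_cong) (auto simp: incident)
  then show ?thesis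
    using k dist unfolding is_cycle_def reachable induced_subgraph_def cycle_edges_def
    by (auto intro!: exI[of _ vs])
qed

text \<open>Separates the even from the odd positions of a cycle, that is, the edges of one matching
  from those of the other.\<close>

lemma mset_set_lessThan_double:
  "mset_set {..<2 * m} = {#2 * l. l \<in># mset_set {..<m}#} + {#Suc (2 * l). l \<in># mset_set {..<m}#}"
  for m :: nat
  by (induction m) (auto simp: lessThan_Suc)

section \<open>Two matchings whose union consists of cycles\<close>

text \<open>The pairs in \<open>P\<close> are ordered because \<open>f\<close> leads from the copy
  of \<open>X\<close> at \<open>a\<close> to the copy at \<open>b\<close>.\<close>

definition lifted_matching :: "('b \<times> 'b) set \<Rightarrow> 'a set \<Rightarrow> ('a \<Rightarrow> 'a) \<Rightarrow> ('b \<times> 'a) set set" where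
  "lifted_matching P X f = (\<lambda>((a, b), x). {(a, x), (b, f x)}) ` (P \<times> X)"

text \<open>The sequence \<open>z\<close> runs once through an orbit of length \<open>m\<close> of \<open>\<tau>\<^sup>-\<^sup>1 \<circ> \<sigma>\<close>.\<close>

definition alternating_orbit :: "'a set \<Rightarrow> ('a \<Rightarrow> 'a) \<Rightarrow> ('a \<Rightarrow> 'a) \<Rightarrow> nat \<Rightarrow> (nat \<Rightarrow> 'a) \<Rightarrow> bool" where
  "alternating_orbit X \<sigma> \<tau> m z \<longleftrightarrow>
     inj_on z {..<m} \<and> z ` {..m} \<subseteq> X \<and> z m = z 0 \<and> (\<forall>l<m. \<tau> (z (Suc l)) = \<sigma> (z l))"

text \<open>The cycle is \<open>(a, z 0)\<close>, \<open>(b, \<sigma> (z 0))\<close>,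
  \<open>(a, z 1)\<close>, \<open>(b, \<sigma> (z 1))\<close> and so on. Its edges alternate between
  the matchings, since \<open>\<tau> (z (Suc l)) = \<sigma> (z l)\<close>. Each matching has only
  one edge at a vertex, so no other edge meets the cycle.\<close>

lemma cycle_through_alternating_orbit:
  fixes P :: "('b \<times> 'b) set"
  assumes fin: "finite P" "finite X"
    and \<sigma>: "bij_betw \<sigma> X X" and \<tau>: "bij_betw \<tau> X X"
    and disj: "\<And>a b a' b'. (a, b) \<in> P \<Longrightarrow> (a', b') \<in> P \<Longrightarrow> {a, b} \<inter> {a', b'} \<noteq> {} \<Longrightarrow> a = a' \<and> b = b'"
    and ab: "(a, b) \<in> P" "a \<noteq> b"
    and orb: "alternating_orbit X \<sigma> \<tau> m z"
  obtains vs where "distinct vs" "length vs = 2 * m"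
    "set vs = {a} \<times> z ` {..<m} \<union> {b} \<times> \<sigma> ` z ` {..<m}"
    "{#e \<in># mset_set (lifted_matching P X \<sigma>) + mset_set (lifted_matching P X \<tau>).
        e \<inter> set vs \<noteq> {}#} = cycle_edges vs"
proof -
  have zinj: "inj_on z {..<m}" and zX: "\<And>l. l \<le> m \<Longrightarrow> z l \<in> X" and zm: "z m = z 0"
    and zstep: "\<And>l. l < m \<Longrightarrow> \<tau> (z (Suc l)) = \<sigma> (z l)"
    using orb by (auto simp: alternating_orbit_def)
  have zsub: "z ` {..<m} \<subseteq> X" using zX by auto
  have \<sigma>inj: "inj_on \<sigma> X" and \<tau>inj: "inj_on \<tau> X"
    using \<sigma> \<tau> by (auto simp: bij_betw_def)
  have \<sigma>zinj: "inj_on (\<lambda>l. \<sigma> (z l)) {..<m}"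
    using zinj \<sigma>inj zX by (auto simp: inj_on_def)
  define f where "f i = (if even i then (a, z (i div 2)) else (b, \<sigma> (z (i div 2))))" for i
  define vs where "vs = map f [0..<2 * m]"
  have len: "length vs = 2 * m" by (simp add: vs_def)
  have f_even [simp]: "f (2 * l) = (a, z l)" and f_odd [simp]: "f (Suc (2 * l)) = (b, \<sigma> (z l))" for l
    by (simp_all add: f_def)
  have split: "{..<2 * m} = (\<lambda>l. 2 * l) ` {..<m} \<union> (\<lambda>l. Suc (2 * l)) ` {..<m}"
    using arg_cong[OF mset_set_lessThan_double[of m], of set_mset] by simp
  have set_vs: "set vs = {a} \<times> z ` {..<m} \<union> {b} \<times> \<sigma> ` z ` {..<m}"
    unfolding vs_def set_map set_upt atLeast0LessThan split image_Un image_image by auto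
  have "inj_on f {..<2 * m}"
    unfolding split using zinj \<sigma>zinj ab(2) by (auto simp: inj_on_def)
  then have dist: "distinct vs" by (simp add: vs_def distinct_map atLeast0LessThan)
  have nth_even: "vs ! (2 * l) = (a, z l)" and nth_odd: "vs ! Suc (2 * l) = (b, \<sigma> (z l))"
    if "l < m" for l using that by (simp_all add: vs_def)
  have nth_next: "vs ! (Suc (Suc (2 * l)) mod (2 * m)) = (a, z (Suc l))" if "l < m" for l
  proof (cases "Suc l = m")
    case True
    then have "Suc (Suc (2 * l)) mod (2 * m) = 0" by auto
    then show ?thesis using that nth_even[of 0] True zm by simp
  next
    case False
    then have "Suc (Suc (2 * l)) mod (2 * m) = 2 * Suc l" "Suc l < m" using that by simp_all
    then show ?thesis using nth_even by metis
  qed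
  let ?A = "\<lambda>l. {(a, z l), (b, \<sigma> (z l))}" and ?B = "\<lambda>l. {(b, \<sigma> (z l)), (a, z (Suc l))}"
  have "cycle_edges vs = {#?A l. l \<in># mset_set {..<m}#} + {#?B l. l \<in># mset_set {..<m}#}"
    unfolding cycle_edges_def len mset_set_lessThan_double image_mset_union image_mset.compositionality
    by (intro arg_cong2[of _ _ _ _ "(+)"] image_mset_cong)
      (auto simp: nth_even nth_odd nth_next)
  also have "\<dots> = mset_set (?A ` {..<m}) + mset_set (?B ` {..<m})"
    using ab(2) zinj \<sigma>zinj
    by (intro arg_cong2[of _ _ _ _ "(+)"] image_mset_mset_set inj_onI)
      (auto simp: doubleton_eq_iff inj_on_def)
  also have "?A ` {..<m} = {e \<in> lifted_matching P X \<sigma>. e \<inter> set vs \<noteq> {}}" (is "?L = ?R")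
  proof
    show "?L \<subseteq> ?R"
    proof
      fix e assume "e \<in> ?L"
      then obtain l where l: "l < m" "e = ?A l" by auto
      then have "e \<in> lifted_matching P X \<sigma>"
        using ab zX[of l] unfolding lifted_matching_def by (intro image_eqI[of _ _ "((a, b), z l)"]) auto
      then show "e \<in> ?R" using l unfolding set_vs by auto
    qed
    show "?R \<subseteq> ?L"
    proof
      fix e assume "e \<in> ?R"
      then obtain a' b' x where e: "(a', b') \<in> P" "x \<in> X" "e = {(a', x), (b', \<sigma> x)}" "e \<inter> set vs \<noteq> {}"
        by (auto simp: lifted_matching_def)
      then have "{a, b} \<inter> {a', b'} \<noteq> {}" unfolding set_vs by auto
      with disj[OF ab(1) e(1)] have "a' = a" "b' = b" by auto
      with e(4) ab(2) have "x \<in> z ` {..<m} \<or> \<sigma> x \<in> \<sigma> ` z ` {..<m}"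
        unfolding e(3) set_vs by auto
      then have "x \<in> z ` {..<m}"
        using e(2) zsub \<sigma>inj inj_on_image_mem_iff by metis
      then show "e \<in> ?L" using e(3) \<open>a' = a\<close> \<open>b' = b\<close> by auto
    qed
  qed
  also have "?B ` {..<m} = {e \<in> lifted_matching P X \<tau>. e \<inter> set vs \<noteq> {}}" (is "?L = ?R")
  proof
    show "?L \<subseteq> ?R"
    proof
      fix e assume "e \<in> ?L"
      then obtain l where l: "l < m" "e = ?B l" by auto
      then have "e \<in> lifted_matching P X \<tau>"
        using ab zX[of "Suc l"] zstep[of l] unfolding lifted_matching_def
        by (intro image_eqI[of _ _ "((a, b), z (Suc l))"]) auto
      then show "e \<in> ?R" using l unfolding set_vs by auto
    qed
    show "?R \<subseteq> ?L"
    proof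
      fix e assume "e \<in> ?R"
      then obtain a' b' x where e: "(a', b') \<in> P" "x \<in> X" "e = {(a', x), (b', \<tau> x)}" "e \<inter> set vs \<noteq> {}"
        by (auto simp: lifted_matching_def)
      then have "{a, b} \<inter> {a', b'} \<noteq> {}" unfolding set_vs by auto
      with disj[OF ab(1) e(1)] have eq: "a' = a" "b' = b" by auto
      with e(4) ab(2) have "x \<in> z ` {..<m} \<or> \<tau> x \<in> \<sigma> ` z ` {..<m}"
        unfolding e(3) set_vs by auto
      \<comment> \<open>Edges of \<open>\<tau>\<close> are indexed by their end
        \<open>z (Suc l)\<close>, so the index is shifted by one and \<open>z 0\<close> has to
        appear as \<open>z m\<close>.\<close>
      then have "\<exists>l<m. x = z (Suc l)"
      proof
        assume "x \<in> z ` {..<m}"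
        then obtain l where l: "l < m" "x = z l" by auto
        show ?thesis
        proof (cases l)
          case 0
          then show ?thesis using l zm by (intro exI[of _ "m - 1"]) auto
        next
          case (Suc l')
          then show ?thesis using l by (intro exI[of _ l']) auto
        qed
      next
        assume "\<tau> x \<in> \<sigma> ` z ` {..<m}"
        then obtain l where l: "l < m" "\<tau> x = \<tau> (z (Suc l))" by (auto simp: zstep)
        then show ?thesis using e(2) zX[of "Suc l"] \<tau>inj by (auto simp: inj_on_def)
      qed
      then show "e \<in> ?L" using e(3) eq zstep by auto
    qed
  qed
  finally have "{#e \<in># mset_set (lifted_matching P X \<sigma>) + mset_set (lifted_matching P X \<tau>).
        e \<inter> set vs \<noteq> {}#} = cycle_edges vs"
    using fin by (simp add: lifted_matching_def)
  then show ?thesis using that dist len set_vs by blast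
qed

section \<open>Near-one-factorisations of complete graphs of odd order\<close>

text \<open>The condition \<open>a < b\<close> lists every edge once and fixes the direction in
  which a derangement is applied to it.\<close>

definition near_factor :: "nat \<Rightarrow> nat \<Rightarrow> (nat \<times> nat) set" where
  "near_factor u i = {(a, b). a \<in> {1..u} \<and> b \<in> {1..u} \<and> a < b \<and> [a + b = 2 * i] (mod u)}"

lemma cong_imp_eq_upto:
  fixes x y u :: nat
  assumes "x \<in> {1..u}" "y \<in> {1..u}" "[x = y] (mod u)"
  shows "x = y"
proof -
  have "x = y" if "x \<in> {1..u}" "y \<in> {1..u}" "[x = y] (mod u)" "x \<le> y" for x y :: nat
  proof -
    have "u dvd y - x" using that cong_altdef_nat[OF \<open>x \<le> y\<close>] cong_sym by blast
    moreover have "y - x < u" using that by auto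
    ultimately show ?thesis using that(4) nat_dvd_not_less by (cases "x = y") auto
  qed
  from this[of x y] this[of y x] show ?thesis using assms cong_sym linear by metis
qed

lemma representative_upto:
  fixes n u :: nat
  assumes "u > 0"
  obtains y where "y \<in> {1..u}" "[y = n] (mod u)"
proof
  \<comment> \<open>Residue 0 is represented by \<open>u\<close>, since vertices are numbered from
    1.\<close>
  let ?y = "if n mod u = 0 then u else n mod u"
  show "?y \<in> {1..u}" using assms by (auto simp: less_imp_le)
  show "[?y = n] (mod u)" by (auto simp: cong_def)
qed

lemma finite_near_factor: "finite (near_factor u i)"
  by (rule finite_subset[of _ "{1..u} \<times> {1..u}"]) (auto simp: near_factor_def)

lemma near_factor_avoids:
  assumes "(a, b) \<in> near_factor u i" "i \<in> {1..u}"
  shows "a \<noteq> i" "b \<noteq> i"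
proof -
  have ab: "a \<in> {1..u}" "b \<in> {1..u}" "a < b" "[a + b = i + i] (mod u)"
    using assms by (auto simp: near_factor_def mult_2)
  show "a \<noteq> i"
  proof
    assume "a = i"
    with ab have "[b = i] (mod u)" by (simp add: cong_add_lcancel_nat)
    with ab \<open>a = i\<close> show False using cong_imp_eq_upto[of b u i] assms by auto
  qed
  show "b \<noteq> i"
  proof
    assume "b = i"
    with ab have "[a = i] (mod u)" by (simp add: cong_add_rcancel_nat)
    with ab \<open>b = i\<close> show False using cong_imp_eq_upto[of a u i] assms by auto
  qed
qed

text \<open>The partner of \<open>x\<close> is determined by its residue \<open>2 * i - x\<close>
  modulo \<open>u\<close>.\<close>

lemma near_factor_disjoint:
  assumes "(a, b) \<in> near_factor u i" "(a', b') \<in> near_factor u i" "{a, b} \<inter> {a', b'} \<noteq> {}"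
  shows "a = a' \<and> b = b'"
proof -
  have partner: "y = y'"
    if "[x + y = 2 * i] (mod u)" "[x + y' = 2 * i] (mod u)" "y \<in> {1..u}" "y' \<in> {1..u}" for x y y'
  proof -
    have "[x + y = x + y'] (mod u)" using that cong_sym cong_trans by blast
    then have "[y = y'] (mod u)" by (simp add: cong_add_lcancel_nat)
    then show ?thesis using that cong_imp_eq_upto by blast
  qed
  from assms(3) consider "a = a'" | "a = b'" | "b = a'" | "b = b'" by auto
  then show ?thesis
  proof cases
    case 1 with assms partner[of a b b'] show ?thesis by (auto simp: near_factor_def)
  next
    case 2 with assms partner[of a b a'] show ?thesis by (auto simp: near_factor_def add.commute)
  next
    case 3 with assms partner[of b a b'] show ?thesis by (auto simp: near_factor_def add.commute)
  next
    case 4 with assms partner[of b a a'] show ?thesis by (auto simp: near_factor_def add.commute)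
  qed
qed

lemma double_cong_imp_eq:
  fixes a b u :: nat
  assumes "odd u" "a \<in> {1..u}" "b \<in> {1..u}" "[2 * a = 2 * b] (mod u)"
  shows "a = b"
proof -
  have "coprime 2 u" using assms(1) by simp
  then have "[a = b] (mod u)" using assms(4) cong_mult_lcancel_nat by blast
  then show ?thesis using assms cong_imp_eq_upto by blast
qed

text \<open>The partner of \<open>a\<close> is \<open>2 * i - a\<close> modulo \<open>u\<close>; for
  odd \<open>u\<close> it equals \<open>a\<close> only if \<open>a = i\<close>. The two outcomes
  reflect the ordering of the pair.\<close>

lemma near_factor_covers:
  assumes "odd u" "i \<in> {1..u}" "a \<in> {1..u}" "a \<noteq> i"
  obtains b where "(a, b) \<in> near_factor u i" | b where "(b, a) \<in> near_factor u i"
proof -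
  obtain b where b: "b \<in> {1..u}" "[b = 2 * i + (u - a)] (mod u)"
    using representative_upto[of u] assms by (metis odd_pos)
  have "[a + b = a + (2 * i + (u - a))] (mod u)" using b(2) cong_add_lcancel_nat by blast
  also have "a + (2 * i + (u - a)) = 2 * i + u" using assms by auto
  also have "[2 * i + u = 2 * i] (mod u)" by (simp add: cong_def)
  finally have sum: "[a + b = 2 * i] (mod u)" .
  have "a \<noteq> b"
  proof
    assume "a = b"
    with sum have "[2 * a = 2 * i] (mod u)" by (simp add: mult_2)
    with double_cong_imp_eq assms show False by blast
  qed
  then have "(a, b) \<in> near_factor u i \<or> (b, a) \<in> near_factor u i"
    using sum b assms by (auto simp: near_factor_def add.commute[of b a])
  then show ?thesis using that by blast
qed

lemma ex1_near_factor:
  assumes "odd u" "a \<in> {1..u}" "b \<in> {1..u}" "a < b"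
  shows "\<exists>!i. i \<in> {1..u} \<and> (a, b) \<in> near_factor u i"
proof -
  \<comment> \<open>For odd \<open>u\<close> the number \<open>(u + 1) div 2\<close> is the inverse
    of 2 modulo \<open>u\<close>, so \<open>i\<close> is half of \<open>a + b\<close>.\<close>
  obtain i where i: "i \<in> {1..u}" "[i = (a + b) * ((u + 1) div 2)] (mod u)"
    using representative_upto[of u] assms by (metis odd_pos)
  have "[2 * i = 2 * ((a + b) * ((u + 1) div 2))] (mod u)" using i(2) cong_scalar_left by blast
  also have "2 * ((a + b) * ((u + 1) div 2)) = (a + b) * (2 * ((u + 1) div 2))" by simp
  also have "\<dots> = (a + b) + (a + b) * u" using assms(1) by simp
  also have "[(a + b) + (a + b) * u = a + b] (mod u)" by (simp add: cong_def)
  finally have "[2 * i = a + b] (mod u)" .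
  then have "(a, b) \<in> near_factor u i" using assms by (auto simp: near_factor_def cong_sym)
  moreover have "i' = i''" if "i' \<in> {1..u}" "i'' \<in> {1..u}"
      "(a, b) \<in> near_factor u i'" "(a, b) \<in> near_factor u i''" for i' i''
  proof -
    have "[2 * i' = 2 * i''] (mod u)" using that unfolding near_factor_def
      by (auto intro: cong_trans cong_sym)
    with double_cong_imp_eq assms(1) that show ?thesis by blast
  qed
  ultimately show ?thesis using i by blast
qed

section \<open>From cyclically arranged derangements to cycle systems\<close>

lemma sum_mset_set_disjoint:
  assumes "finite I" "\<And>p. p \<in> I \<Longrightarrow> finite (M p)"
    and "\<And>p q. p \<in> I \<Longrightarrow> q \<in> I \<Longrightarrow> p \<noteq> q \<Longrightarrow> M p \<inter> M q = {}"
  shows "(\<Sum>p\<in>I. mset_set (M p)) = mset_set (\<Union>p\<in>I. M p)"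
  using assms
proof (induction I)
  case (insert p I)
  have "M p \<inter> (\<Union>q\<in>I. M q) = {}" using insert by blast
  then have "mset_set (M p \<union> (\<Union>q\<in>I. M q)) = mset_set (M p) + mset_set (\<Union>q\<in>I. M q)"
    using insert by (intro mset_set_Union) auto
  with insert show ?case by simp
qed simp

text \<open>The derangements \<open>\<rho> j\<close> partition the ordered pairs of distinct points.
  The condition \<open>orbit\<close> makes \<open>\<rho> j\<close> and its successor
  \<open>\<rho> (\<pi> j)\<close> combine into cycles of length \<open>2 * m\<close>.\<close>

locale cyclic_derangements =
  fixes X :: "'a set" and J :: "'j set" and \<rho> :: "'j \<Rightarrow> 'a \<Rightarrow> 'a" and \<pi> :: "'j \<Rightarrow> 'j" and m :: nat
  assumes finite_points: "finite X" and finite_index: "finite J"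
    and bij_next: "bij_betw \<pi> J J"
    and bij_perm: "j \<in> J \<Longrightarrow> bij_betw (\<rho> j) X X"
    and derangement: "j \<in> J \<Longrightarrow> x \<in> X \<Longrightarrow> \<rho> j x \<noteq> x"
    and sharply_transitive: "x \<in> X \<Longrightarrow> y \<in> X \<Longrightarrow> x \<noteq> y \<Longrightarrow> \<exists>!j. j \<in> J \<and> \<rho> j x = y"
    and orbit: "j \<in> J \<Longrightarrow> x \<in> X \<Longrightarrow> \<exists>z. alternating_orbit X (\<rho> j) (\<rho> (\<pi> j)) m z \<and> x \<in> z ` {..<m}"

text \<open>Conjugation by a bijection preserves all the conditions, so a convenient point set may
  be replaced by \<open>{1..g}\<close>.\<close>

lemma (in cyclic_derangements) transport:
  assumes f: "bij_betw f X Y"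
  shows "cyclic_derangements Y J (\<lambda>j. f \<circ> \<rho> j \<circ> inv_into X f) \<pi> m"
proof -
  let ?g = "inv_into X f"
  have g: "bij_betw ?g Y X" using f by (rule bij_betw_inv_into)
  have gX: "?g y \<in> X" and fg: "f (?g y) = y" if "y \<in> Y" for y
    using that f g by (auto simp: bij_betw_def f_inv_into_f)
  have gf: "?g (f x) = x" and fY: "f x \<in> Y" if "x \<in> X" for x
    using that f by (auto simp: bij_betw_def)
  have perm: "\<rho> j x \<in> X" if "j \<in> J" "x \<in> X" for j x
    using bij_perm[OF that(1)] that(2) by (auto simp: bij_betw_def)
  show ?thesis
  proof
    show "finite Y" using f finite_points by (simp add: bij_betw_finite)
    show "finite J" "bij_betw \<pi> J J" by (fact finite_index bij_next)+
  next
    fix j assume "j \<in> J"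
    then show "bij_betw (f \<circ> \<rho> j \<circ> ?g) Y Y"
      using f g bij_perm by (blast intro: bij_betw_trans)
  next
    fix j y assume "j \<in> J" "y \<in> Y"
    then show "(f \<circ> \<rho> j \<circ> ?g) y \<noteq> y"
      using derangement[of j "?g y"] gX perm gf by (metis comp_apply)
  next
    fix x y assume xy: "x \<in> Y" "y \<in> Y" "x \<noteq> y"
    have "(f \<circ> \<rho> j \<circ> ?g) x = y \<longleftrightarrow> \<rho> j (?g x) = ?g y" if "j \<in> J" for j
      using that xy gX perm gf fg by (metis comp_apply)
    moreover have "?g x \<noteq> ?g y" using xy fg by metis
    ultimately show "\<exists>!j. j \<in> J \<and> (f \<circ> \<rho> j \<circ> ?g) x = y"
      using sharply_transitive[of "?g x" "?g y"] gX xy by metis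
  next
    fix j y assume jy: "j \<in> J" "y \<in> Y"
    then obtain z where z: "alternating_orbit X (\<rho> j) (\<rho> (\<pi> j)) m z" "?g y \<in> z ` {..<m}"
      using orbit gX by blast
    then have "alternating_orbit Y (f \<circ> \<rho> j \<circ> ?g) (f \<circ> \<rho> (\<pi> j) \<circ> ?g) m (f \<circ> z)"
      using f gf fY unfolding alternating_orbit_def bij_betw_def
      by (auto simp: inj_on_def image_subset_iff)
    moreover have "y \<in> (f \<circ> z) ` {..<m}" using z(2) fg[OF jy(2)] by force
    ultimately show "\<exists>z. alternating_orbit Y (f \<circ> \<rho> j \<circ> ?g) (f \<circ> \<rho> (\<pi> j) \<circ> ?g) m z \<and> y \<in> z ` {..<m}"
      by blast
  qed
qed

text \<open>Writing every edge with its smaller part first matches the ordered pairs of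
  \<open>near_factor\<close>.\<close>

lemma gedges_tensor_complete:
  "gedges (tensor_product (complete_graph u) (complete_graph g)) =
     {{(a, x), (b, y)} | a x b y. a \<in> {1..u} \<and> b \<in> {1..u} \<and> a < b \<and> x \<in> {1..g} \<and> y \<in> {1..g} \<and> x \<noteq> y}"
    (is "?E = ?R")
proof
  show "?R \<subseteq> ?E" unfolding tensor_product_def complete_graph_def by simp blast
  show "?E \<subseteq> ?R"
  proof
    fix e assume "e \<in> ?E"
    then obtain a x b y where e: "e = {(a, x), (b, y)}"
      and ab: "{a, b} \<in> gedges (complete_graph u)" and xy: "{x, y} \<in> gedges (complete_graph g)"
      unfolding tensor_product_def by auto
    from ab have ab': "a \<in> {1..u}" "b \<in> {1..u}" "a \<noteq> b"
      by (auto simp: complete_graph_def doubleton_eq_iff)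
    from xy have xy': "x \<in> {1..g}" "y \<in> {1..g}" "x \<noteq> y"
      by (auto simp: complete_graph_def doubleton_eq_iff)
    show "e \<in> ?R"
    proof (cases "a < b")
      case True
      with e ab' xy' show ?thesis by blast
    next
      case False
      then have "b < a" using ab' by simp
      moreover have "e = {(b, y), (a, x)}" using e by blast
      ultimately show ?thesis using ab' xy' by blast
    qed
  qed
qed

lemma finite_gedges_tensor_complete:
  "finite (gedges (tensor_product (complete_graph u) (complete_graph g)))"
  by (rule finite_subset[of _ "Pow ({1..u} \<times> {1..g})"]) (auto simp: gedges_tensor_complete)

text \<open>The matchings \<open>M (i, j)\<close> partition the simple edge set \<open>E\<close>.
  The factor \<open>F (i, j)\<close> joins \<open>M (i, j)\<close> to \<open>M (i, \<pi> j)\<close>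
  and misses part \<open>i\<close>; as \<open>\<pi>\<close> permutes \<open>J\<close>, all factors
  together use every matching twice.\<close>

lemma (in cyclic_derangements) ARCS_exists:
  fixes u g :: nat
  assumes X: "inj_on f X" "f ` X = {1..g}" and u: "odd u" and m: "m \<ge> 2"
  shows "\<exists>D. is_ARCS (2 * m) u g 2 D"
proof -
  let ?Y = "{1..g}"
  define \<sigma> where "\<sigma> j = f \<circ> \<rho> j \<circ> inv_into X f" for j
  interpret Y: cyclic_derangements ?Y J \<sigma> \<pi> m
    unfolding \<sigma>_def using X by (intro transport) (simp add: bij_betw_def)
  define E where "E = gedges (tensor_product (complete_graph u) (complete_graph g))"
  define M where "M = (\<lambda>(i, j). lifted_matching (near_factor u i) ?Y (\<sigma> j))"
  define I where "I = {1..u} \<times> J"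
  define F where "F = (\<lambda>(i, j). \<lparr>mverts = ({1..u} - {i}) \<times> ?Y,
    medges = mset_set (M (i, j)) + mset_set (M (i, \<pi> j))\<rparr>)"
  have finE: "finite E" unfolding E_def by (rule finite_gedges_tensor_complete)
  have finI: "finite I" unfolding I_def by (simp add: Y.finite_index)
  have \<sigma>Y: "\<sigma> j x \<in> ?Y" if "j \<in> J" "x \<in> ?Y" for j x
    using Y.bij_perm[OF that(1)] that(2) unfolding bij_betw_def by blast
  have \<pi>J: "\<pi> j \<in> J" if "j \<in> J" for j using Y.bij_next that by (auto simp: bij_betw_def)
  have M_iff: "e \<in> M (i, j) \<longleftrightarrow>
      (\<exists>a b x. e = {(a, x), (b, \<sigma> j x)} \<and> (a, b) \<in> near_factor u i \<and> x \<in> ?Y)" for e i j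
    unfolding M_def lifted_matching_def by (simp add: image_iff split_beta Bex_def) blast
  have M_avoid: "e \<subseteq> ({1..u} - {i}) \<times> ?Y" if e_in: "e \<in> M (i, j)" "i \<in> {1..u}" "j \<in> J" for e i j
  proof -
    obtain a b x where e: "e = {(a, x), (b, \<sigma> j x)}" "(a, b) \<in> near_factor u i" "x \<in> ?Y"
      using e_in(1) unfolding M_iff by blast
    have "a \<in> {1..u} - {i}" "b \<in> {1..u} - {i}"
      using near_factor_avoids[OF e(2) e_in(2)] e(2) by (auto simp: near_factor_def)
    then show ?thesis using \<sigma>Y[OF e_in(3) e(3)] e(1,3) by blast
  qed
  have M_E: "M p \<subseteq> E" if pI: "p \<in> I" for p
  proof
    fix e assume e: "e \<in> M p"
    obtain i j where p: "p = (i, j)" "i \<in> {1..u}" "j \<in> J" using pI unfolding I_def by blast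
    then obtain a b x where "e = {(a, x), (b, \<sigma> j x)}" "(a, b) \<in> near_factor u i" "x \<in> ?Y"
      using e unfolding M_iff p(1) by blast
    moreover from this have "x \<noteq> \<sigma> j x" using Y.derangement p by metis
    ultimately show "e \<in> E" unfolding E_def gedges_tensor_complete near_factor_def
      using \<sigma>Y[OF p(3)] by blast
  qed
  have M_fin: "finite (M p)" if "p \<in> I" for p using M_E[OF that] finE finite_subset by blast
  have M_Un: "(\<Union>p\<in>I. M p) = E"
  proof
    show "E \<subseteq> (\<Union>p\<in>I. M p)"
    proof
      fix e assume "e \<in> E"
      then obtain a x b y where e: "e = {(a, x), (b, y)}" "a \<in> {1..u}" "b \<in> {1..u}" "a < b"
          "x \<in> ?Y" "y \<in> ?Y" "x \<noteq> y"
        unfolding E_def gedges_tensor_complete by blast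
      obtain i where i: "i \<in> {1..u}" "(a, b) \<in> near_factor u i" using ex1_near_factor[OF u e(2-4)] by blast
      obtain j where j: "j \<in> J" "\<sigma> j x = y" using Y.sharply_transitive[OF e(5-7)] by blast
      have "e \<in> M (i, j)" unfolding M_iff using e(1,5) i(2) j(2) by blast
      then show "e \<in> (\<Union>p\<in>I. M p)" using i j unfolding I_def by blast
    qed
  qed (use M_E in blast)
  have M_disj: "M p \<inter> M q = {}" if pqI: "p \<in> I" "q \<in> I" and neq: "p \<noteq> q" for p q
  proof (rule ccontr)
    obtain i j i' j' where p: "p = (i, j)" "i \<in> {1..u}" "j \<in> J" and q: "q = (i', j')" "i' \<in> {1..u}" "j' \<in> J"
      using pqI unfolding I_def by blast
    assume "M p \<inter> M q \<noteq> {}"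
    then obtain e where "e \<in> M (i, j)" "e \<in> M (i', j')" using p q by blast
    then obtain a b x a' b' x' where e: "e = {(a, x), (b, \<sigma> j x)}" "e = {(a', x'), (b', \<sigma> j' x')}"
      "(a, b) \<in> near_factor u i" "(a', b') \<in> near_factor u i'" "x \<in> ?Y" "x' \<in> ?Y"
      unfolding M_iff by blast
    have less: "a < b" "a' < b'" "a \<in> {1..u}" "b \<in> {1..u}" using e unfolding near_factor_def by auto
    have eq: "a = a'" "b = b'" "x = x'" "\<sigma> j x = \<sigma> j' x'"
      using e(1,2) less by (auto simp: doubleton_eq_iff)
    have "i = i'" using ex1_near_factor[OF u less(3,4,1)] e eq p q by blast
    moreover have "j = j'"
      \<comment> \<open>Sharp transitivity speaks only of distinct points, so the absence of fixed
        points enters here.\<close>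
      using Y.sharply_transitive[of x "\<sigma> j x"] Y.derangement[of j x] \<sigma>Y[of j x] e(5) eq p q by metis
    ultimately show False using neq p q by blast
  qed
  have verts: "delete_verts (tensor_multigraph u g 2) (partite_set g i) =
      \<lparr>mverts = ({1..u} - {i}) \<times> ?Y,
       medges = {#e \<in># repeat_mset 2 (mset_set E). e \<inter> {i} \<times> ?Y = {}#}\<rparr>" for i
    unfolding delete_verts_def tensor_multigraph_def multiply_edges_def partite_set_def E_def
    by (auto simp: tensor_product_def complete_graph_def)
  have factor: "partial_cycle_factor (2 * m) u g 2 (F p)" if pI: "p \<in> I" for p
  proof -
    obtain i j where p: "p = (i, j)" "i \<in> {1..u}" "j \<in> J" using pI unfolding I_def by blast
    have in_I: "(i, j) \<in> I" "(i, \<pi> j) \<in> I" using p \<pi>J by (auto simp: I_def)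
    \<comment> \<open>Each matching lies in the simple graph without part \<open>i\<close>, so the
      sum of two matchings fits under two copies of that graph.\<close>
    have count_M: "count (mset_set (M (i, j'))) e \<le> count (mset_set {e \<in> E. e \<inter> {i} \<times> ?Y = {}}) e"
      if "j' \<in> J" for j' e
    proof -
      have "(i, j') \<in> I" using that p by (simp add: I_def)
      then have "M (i, j') \<subseteq> {e \<in> E. e \<inter> {i} \<times> ?Y = {}}"
        using M_E M_avoid[of _ i j'] that p by blast
      then have "mset_set (M (i, j')) \<subseteq># mset_set {e \<in> E. e \<inter> {i} \<times> ?Y = {}}"
        using finE by (intro subset_imp_msubset_mset_set) auto
      then show ?thesis by (simp add: mset_subset_eq_count)
    qed
    have "medges (F p) \<subseteq># {#e \<in># repeat_mset 2 (mset_set E). e \<inter> {i} \<times> ?Y = {}#}"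
    proof (rule mset_subset_eqI)
      fix e
      have "count (medges (F p)) e \<le> 2 * count (mset_set {e \<in> E. e \<inter> {i} \<times> ?Y = {}}) e"
        using count_M[of j e] count_M[of "\<pi> j" e] p \<pi>J by (simp add: F_def)
      also have "\<dots> = count {#e \<in># repeat_mset 2 (mset_set E). e \<inter> {i} \<times> ?Y = {}#} e"
        using finE by (simp add: count_mset_set')
      finally show "count (medges (F p)) e \<le>
        count {#e \<in># repeat_mset 2 (mset_set E). e \<inter> {i} \<times> ?Y = {}#} e" .
    qed
    moreover have F_edges: "e \<in> M (i, j) \<or> e \<in> M (i, \<pi> j)" if "e \<in># medges (F p)" for e
      using that p M_fin in_I by (auto simp: F_def)
    ultimately have span: "spanning_subgraph (F p) (delete_verts (tensor_multigraph u g 2) (partite_set g i))"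
      unfolding verts spanning_subgraph_def subgraph_def using M_avoid p \<pi>J
      by (fastforce simp: F_def)
    have cycles: "is_cycle (2 * m) C" if C: "C \<in> components (F p)" for C
    proof -
      obtain v where v: "v \<in> mverts (F p)"
          "C = induced_subgraph (F p) {y \<in> mverts (F p). (adjacent (F p))\<^sup>*\<^sup>* v y}"
        using C unfolding components_def by blast
      have "v \<in> ({1..u} - {i}) \<times> ?Y" using v(1) p by (simp add: F_def)
      then obtain c y where cy: "v = (c, y)" "c \<in> {1..u}" "c \<noteq> i" "y \<in> ?Y" by blast
      \<comment> \<open>Orbits consist of points over the smaller element of a pair. A vertex over
        the larger element is reached by pulling its point back along
        \<open>\<sigma> j\<close>.\<close>
      obtain a b x where abx: "(a, b) \<in> near_factor u i" "x \<in> ?Y" "v = (a, x) \<or> v = (b, \<sigma> j x)"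
      proof (rule near_factor_covers[OF u p(2) cy(2,3)])
        fix b assume "(c, b) \<in> near_factor u i"
        then show ?thesis using that cy by blast
      next
        fix a assume ac: "(a, c) \<in> near_factor u i"
        obtain x where "x \<in> ?Y" "y = \<sigma> j x"
          using Y.bij_perm[OF p(3)] cy(4) unfolding bij_betw_def by blast
        then show ?thesis using that cy ac by blast
      qed
      obtain z where z: "alternating_orbit ?Y (\<sigma> j) (\<sigma> (\<pi> j)) m z" "x \<in> z ` {..<m}"
        using Y.orbit[OF p(3) abx(2)] by blast
      have "a \<noteq> b" using abx(1) by (auto simp: near_factor_def)
      obtain vs where vs: "distinct vs" "length vs = 2 * m"
          "set vs = {a} \<times> z ` {..<m} \<union> {b} \<times> \<sigma> j ` z ` {..<m}"
          "{#e \<in># mset_set (M (i, j)) + mset_set (M (i, \<pi> j)). e \<inter> set vs \<noteq> {}#} = cycle_edges vs"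
      proof (rule cycle_through_alternating_orbit[OF finite_near_factor Y.finite_points
            Y.bij_perm[OF p(3)] Y.bij_perm[OF \<pi>J[OF p(3)]] _ abx(1) \<open>a \<noteq> b\<close> z(1)])
        fix a b a' b' assume "(a, b) \<in> near_factor u i" "(a', b') \<in> near_factor u i"
          "{a, b} \<inter> {a', b'} \<noteq> {}"
        then show "a = a' \<and> b = b'" by (rule near_factor_disjoint)
      qed (use that in \<open>simp add: M_def\<close>)
      have "z ` {..<m} \<subseteq> ?Y" using z(1) unfolding alternating_orbit_def by auto
      moreover from this have "\<sigma> j ` z ` {..<m} \<subseteq> ?Y" using \<sigma>Y[OF p(3)] by blast
      moreover have "a \<in> {1..u} - {i}" "b \<in> {1..u} - {i}"
        using near_factor_avoids[OF abx(1) p(2)] abx(1) by (auto simp: near_factor_def)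
      ultimately have "set vs \<subseteq> ({1..u} - {i}) \<times> ?Y" unfolding vs(3) by blast
      then have "set vs \<subseteq> mverts (F p)" using p by (simp add: F_def)
      moreover have "v \<in> set vs" using abx(3) z(2) vs(3) by auto
      moreover have "{} \<notin># medges (F p)" using F_edges[of "{}"] unfolding M_iff by blast
      ultimately have "is_cycle (length vs) C"
        unfolding v(2) using vs m p by (intro is_cycle_component) (auto simp: F_def)
      then show ?thesis using vs by simp
    qed
    show ?thesis unfolding partial_cycle_factor_def using p(2) span cycles by blast
  qed
  have bijI: "bij_betw (map_prod id \<pi>) I I"
    unfolding I_def by (intro bij_betw_map_prod bij_betw_id Y.bij_next)
  have sumM: "(\<Sum>p\<in>I. mset_set (M p)) = mset_set E"
    using sum_mset_set_disjoint[OF finI M_fin M_disj] M_Un by simp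
  have "(\<Sum>p\<in>I. medges (F p)) = (\<Sum>p\<in>I. mset_set (M p)) + (\<Sum>p\<in>I. mset_set (M (map_prod id \<pi> p)))"
    unfolding sum.distrib[symmetric] by (rule sum.cong) (auto simp: F_def)
  \<comment> \<open>Reindexing along \<open>\<pi>\<close> shows that the second matchings of the
    factors run through \<open>E\<close> once more.\<close>
  also have "(\<Sum>p\<in>I. mset_set (M (map_prod id \<pi> p))) = (\<Sum>p\<in>I. mset_set (M p))"
    by (rule sum.reindex_bij_betw[OF bijI])
  also have "(\<Sum>p\<in>I. mset_set (M p)) + (\<Sum>p\<in>I. mset_set (M p)) = medges (tensor_multigraph u g 2)"
    unfolding sumM tensor_multigraph_def multiply_edges_def E_def by (simp add: numeral_2_eq_2)
  finally have "(\<Sum>F \<in># image_mset F (mset_set I). medges F) = medges (tensor_multigraph u g 2)"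
    by (simp add: sum_unfold_sum_mset image_mset.compositionality o_def)
  then have "is_ARCS (2 * m) u g 2 (image_mset F (mset_set I))"
    unfolding is_ARCS_def using factor finI by auto
  then show ?thesis by blast
qed

section \<open>A cyclic arrangement of derangements\<close>

lemma dvd_diff_imp_eq:
  fixes x y n :: int
  assumes "n dvd x - y" "x \<in> {0..<n}" "y \<in> {0..<n}"
  shows "x = y"
  using assms by (metis atLeastLessThan_iff mod_eq_dvd_iff mod_pos_pos_trivial)

lemma not_dvd_if_abs_less:
  fixes x n :: int
  assumes "x \<noteq> 0" "\<bar>x\<bar> < n"
  shows "\<not> n dvd x"
  using assms dvd_imp_le_int[of x n] by auto

lemma add_mod_cancel:
  fixes c c' d n :: int
  assumes "(c + d) mod n = (c' + d) mod n" "c \<in> {0..<n}" "c' \<in> {0..<n}"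
  shows "c = c'"
proof -
  have "n dvd c - c'" using assms(1) by (simp add: mod_eq_dvd_iff)
  with assms show ?thesis by (intro dvd_diff_imp_eq)
qed

lemma odd_dvd_double:
  fixes n x :: int
  assumes "odd n" "n dvd 2 * x"
  shows "n dvd x"
proof -
  have "coprime n 2" using assms(1) by simp
  then show ?thesis using assms(2) coprime_dvd_mult_right_iff by blast
qed

section \<open>Reflections of the integers modulo \<open>N\<close> with infinity\<close>

text \<open>The point \<open>N\<close> plays the role of infinity added to the integers modulo \<open>N\<close>.\<close>

definition reflect :: "int \<Rightarrow> int \<Rightarrow> int \<Rightarrow> int" where
  "reflect N h x = (if x = N then h else if x = h then N else (2 * h - x) mod N)"

text \<open>The working form on finite points: arguments may be unreduced representatives, and
  equality with \<open>h\<close> becomes divisibility by \<open>N\<close>. A reduced residue is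
  never \<open>N\<close>, so it cannot be mistaken for infinity.\<close>

lemma reflect_mod:
  assumes "N > 0"
  shows "reflect N (h mod N) (x mod N) = (if N dvd x - h then N else (2 * h - x) mod N)"
proof -
  have "x mod N \<noteq> N" using assms pos_mod_bound[of N x] by linarith
  moreover have "(2 * (h mod N) - x mod N) mod N = (2 * h - x) mod N"
    by (intro mod_diff_cong) (simp_all add: mod_mult_right_eq)
  ultimately show ?thesis unfolding reflect_def by (simp add: mod_eq_dvd_iff)
qed

lemma reflect_infinity [simp]: "reflect N h N = h"
  by (simp add: reflect_def)

lemma reflect_in_range:
  assumes "h \<in> {0..<N}"
  shows "reflect N h x \<in> {0..N}"
  using assms by (auto simp: reflect_def less_imp_le)

lemma reflect_reflect:
  assumes h: "h \<in> {0..<N}" and x: "x \<in> {0..N}"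
  shows "reflect N h (reflect N h x) = x"
proof (cases "x = N \<or> x = h")
  case True
  then show ?thesis using h by (auto simp: reflect_def)
next
  case False
  have N: "N > 0" using h by auto
  have hx: "h mod N = h" "x mod N = x" using h x False by auto
  have "\<not> N dvd x - h" using dvd_diff_imp_eq[of N x h] h x False by auto
  moreover from this have "\<not> N dvd (2 * h - x) - h" by (simp add: dvd_diff_commute)
  ultimately show ?thesis
    using reflect_mod[OF N, of h x] reflect_mod[OF N, of h "2 * h - x"] hx by simp
qed

text \<open>A finite fixed point would give \<open>2 * (h - x)\<close> divisible by the odd
  \<open>N\<close>, hence \<open>x = h\<close>; but \<open>h\<close> is exchanged with
  infinity.\<close>

lemma reflect_neq:
  assumes "odd N" and h: "h \<in> {0..<N}" and x: "x \<in> {0..N}"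
  shows "reflect N h x \<noteq> x"
proof (cases "x = N \<or> x = h")
  case True
  then show ?thesis using h by (auto simp: reflect_def)
next
  case False
  have "\<not> N dvd h - x" using dvd_diff_imp_eq[of N h x] h x False by auto
  then have "\<not> N dvd 2 * (h - x)" using odd_dvd_double[OF \<open>odd N\<close>] by blast
  then have "(2 * h - x) mod N \<noteq> x mod N" by (simp add: mod_eq_dvd_iff algebra_simps)
  then show ?thesis using False x by (auto simp: reflect_def)
qed

text \<open>For finite points \<open>2 * h\<close> must be congruent to \<open>x + y\<close>, and 2
  is invertible modulo the odd \<open>N\<close>. If one point is infinity, \<open>h\<close> is the
  other.\<close>

lemma ex1_reflect:
  assumes N: "odd N" and x: "x \<in> {0..N}" and y: "y \<in> {0..N}" and "x \<noteq> y"
  shows "\<exists>!h. h \<in> {0..<N} \<and> reflect N h x = y"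
proof -
  consider "x = N" | "y = N" "x \<noteq> N" | "x \<noteq> N" "y \<noteq> N" by blast
  then show ?thesis
  proof cases
    case 1
    then show ?thesis using y \<open>x \<noteq> y\<close> by auto
  next
    case 2
    then have "reflect N h x = y \<longleftrightarrow> h = x" if "h \<in> {0..<N}" for h
    proof -
      have "(2 * h - x) mod N < N" using that by (intro pos_mod_bound) auto
      with 2 show ?thesis by (auto simp: reflect_def)
    qed
    then show ?thesis using 2 x by auto
  next
    case 3
    have Npos: "N > 0" using x 3 by auto
    have iff: "reflect N h x = y \<longleftrightarrow> N dvd 2 * h - (x + y)" if h: "h \<in> {0..<N}" for h
    proof (cases "x = h")
      case True
      have "\<not> N dvd x - y" using dvd_diff_imp_eq[of N x y] x y 3 \<open>x \<noteq> y\<close> by auto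
      with True 3 show ?thesis by (auto simp: reflect_def)
    next
      case False
      have "(2 * h - x) mod N = y mod N \<longleftrightarrow> N dvd 2 * h - (x + y)"
        by (simp add: mod_eq_dvd_iff algebra_simps)
      then show ?thesis using False 3 y by (simp add: reflect_def)
    qed
    define h where "h = ((x + y) * ((N + 1) div 2)) mod N"
    have "[2 * h = 2 * ((x + y) * ((N + 1) div 2))] (mod N)"
      unfolding h_def by (intro cong_scalar_left) simp
    also have "2 * ((x + y) * ((N + 1) div 2)) = (x + y) * (2 * ((N + 1) div 2))" by simp
    also have "\<dots> = (x + y) + (x + y) * N" using N by (simp add: algebra_simps)
    also have "[(x + y) + (x + y) * N = x + y] (mod N)" by (simp add: cong_def)
    finally have "N dvd 2 * h - (x + y)" by (simp add: cong_iff_dvd_diff)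
    moreover have "h \<in> {0..<N}" using Npos by (simp add: h_def)
    moreover have "h' = h''" if "h' \<in> {0..<N}" "h'' \<in> {0..<N}"
      "N dvd 2 * h' - (x + y)" "N dvd 2 * h'' - (x + y)" for h' h''
    proof -
      have "N dvd 2 * (h' - h'')" using dvd_diff[OF that(3,4)] by (simp add: algebra_simps)
      then have "N dvd h' - h''" by (rule odd_dvd_double[OF N])
      then show ?thesis using that by (intro dvd_diff_imp_eq)
    qed
    ultimately show ?thesis using iff by metis
  qed
qed

text \<open>Away from infinity, \<open>reflect N (h + m) \<circ> reflect N h\<close> is \<open>x \<mapsto> x + 1\<close>, since
  \<open>2 * m = 1\<close> modulo \<open>N = 2 * m - 1\<close>. Infinity cuts the cycle into two orbits of length \<open>m\<close>.\<close>

lemma reflect_orbit: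
  fixes m :: nat
  defines "N \<equiv> 2 * int m - 1"
  assumes m: "m \<ge> 2" and h: "h \<in> {0..<N}" and x: "x \<in> {0..N}"
  shows "\<exists>z. alternating_orbit {0..N} (reflect N h) (reflect N ((h + int m) mod N)) m z \<and> x \<in> z ` {..<m}"
proof -
  have N: "N > 0" using m by (simp add: N_def)
  have mod_range: "w mod N \<in> {0..<N}" for w using N by simp
  have mod_neq: "w mod N \<noteq> N" "N \<noteq> w mod N" for w using mod_range[of w] by auto
  have hN: "h mod N = h" using h by simp
  note refl_h = reflect_mod[OF N, of h, unfolded hN]
  note refl_h' = reflect_mod[OF N, of "h + int m"]
  have mod_eqI: "v mod N = w mod N" if "v = w + N \<or> w = v + N \<or> v = w" for v w
    using that by auto
  \<comment> \<open>The first orbit is infinity followed by \<open>h + 1\<close> up to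
    \<open>h + m - 1\<close>; the second is \<open>h + m\<close> up to \<open>h + 2 * m - 1\<close>,
    which is \<open>h\<close> modulo \<open>N\<close>. Reducing \<open>l\<close> modulo
    \<open>m\<close> closes both at \<open>l = m\<close>.\<close>
  define z\<^sub>1 where "z\<^sub>1 l = (if l mod m = 0 then N else (h + int l) mod N)" for l :: nat
  define z\<^sub>2 where "z\<^sub>2 l = (h + int m + int (l mod m)) mod N" for l :: nat
  have inj_mod: "i = j" if "(c + int i) mod N = (c + int j) mod N" "i < m" "j < m" for c and i j :: nat
  proof (rule ccontr)
    assume "i \<noteq> j"
    then have "\<not> N dvd int i - int j" using that m by (intro not_dvd_if_abs_less) (auto simp: N_def)
    then show False using that(1) by (simp add: mod_eq_dvd_iff)
  qed
  have "alternating_orbit {0..N} (reflect N h) (reflect N ((h + int m) mod N)) m z\<^sub>1"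
    unfolding alternating_orbit_def
  proof (intro conjI allI impI)
    show "inj_on z\<^sub>1 {..<m}"
    proof (rule inj_onI)
      fix i j assume "i \<in> {..<m}" "j \<in> {..<m}" "z\<^sub>1 i = z\<^sub>1 j"
      then show "i = j" using mod_neq[of "h + int i"] mod_neq[of "h + int j"] inj_mod[of h i j]
        by (cases "i = 0"; cases "j = 0") (simp_all add: z\<^sub>1_def)
    qed
    show "z\<^sub>1 ` {..m} \<subseteq> {0..N}" using mod_range N by (auto simp: z\<^sub>1_def less_imp_le)
    show "z\<^sub>1 m = z\<^sub>1 0" by (simp add: z\<^sub>1_def)
    fix l assume l: "l < m"
    \<comment> \<open>The cases are the step out of infinity, a step between finite points, and the
      step back to infinity.\<close>
    consider "l = 0" | "l > 0" "Suc l < m" | "l > 0" "Suc l = m" using l m by linarith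
    then show "reflect N ((h + int m) mod N) (z\<^sub>1 (Suc l)) = reflect N h (z\<^sub>1 l)"
    proof cases
      case 1
      have "\<not> N dvd h + 1 - (h + int m)" using m by (intro not_dvd_if_abs_less) (auto simp: N_def)
      moreover have "(2 * (h + int m) - (h + 1)) mod N = h mod N" by (intro mod_eqI) (simp add: N_def)
      ultimately show ?thesis using 1 m refl_h'[of "h + 1"] hN by (simp add: z\<^sub>1_def)
    next
      case 2
      have "\<not> N dvd h + int (Suc l) - (h + int m)"
        using 2 by (intro not_dvd_if_abs_less) (auto simp: N_def)
      moreover have "\<not> N dvd h + int l - h" using 2 by (intro not_dvd_if_abs_less) (auto simp: N_def)
      moreover have "(2 * (h + int m) - (h + int (Suc l))) mod N = (2 * h - (h + int l)) mod N"
        by (intro mod_eqI) (simp add: N_def)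
      ultimately show ?thesis using 2 refl_h'[of "h + int (Suc l)"] refl_h[of "h + int l"]
        by (simp add: z\<^sub>1_def)
    next
      case 3
      have "\<not> N dvd h + int l - h" using 3 by (intro not_dvd_if_abs_less) (auto simp: N_def)
      moreover have "(h + int m) mod N = (2 * h - (h + int l)) mod N"
        using 3(2) by (intro mod_eqI) (auto simp: N_def)
      ultimately show ?thesis using 3 refl_h[of "h + int l"] by (simp add: z\<^sub>1_def)
    qed
  qed
  moreover have "alternating_orbit {0..N} (reflect N h) (reflect N ((h + int m) mod N)) m z\<^sub>2"
    unfolding alternating_orbit_def
  proof (intro conjI allI impI)
    show "inj_on z\<^sub>2 {..<m}"
      using inj_mod[of "h + int m"] by (auto simp: z\<^sub>2_def inj_on_def)
    show "z\<^sub>2 ` {..m} \<subseteq> {0..N}" using mod_range N by (auto simp: z\<^sub>2_def less_imp_le)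
    show "z\<^sub>2 m = z\<^sub>2 0" by (simp add: z\<^sub>2_def)
    fix l assume l: "l < m"
    consider "Suc l < m" | "Suc l = m" using l by linarith
    then show "reflect N ((h + int m) mod N) (z\<^sub>2 (Suc l)) = reflect N h (z\<^sub>2 l)"
    proof cases
      case 1
      have "\<not> N dvd h + int m + int (Suc l) - (h + int m)"
        using 1 by (intro not_dvd_if_abs_less) (auto simp: N_def)
      moreover have "\<not> N dvd h + int m + int l - h"
        using 1 by (intro not_dvd_if_abs_less) (auto simp: N_def)
      moreover have "(2 * (h + int m) - (h + int m + int (Suc l))) mod N = (2 * h - (h + int m + int l)) mod N"
        by (intro mod_eqI) (simp add: N_def)
      ultimately show ?thesis
        using 1 refl_h'[of "h + int m + int (Suc l)"] refl_h[of "h + int m + int l"]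
        by (simp add: z\<^sub>2_def)
    next
      case 2
      \<comment> \<open>At the end of the second orbit both sides are infinity:
        \<open>reflect N h\<close> sends \<open>h\<close> there, and the other reflection sends its
        own centre \<open>h + m\<close> there.\<close>
      have "h + int m + int l - h = N" using 2 by (auto simp: N_def)
      then have "reflect N h (z\<^sub>2 l) = N" using refl_h[of "h + int m + int l"] l by (simp add: z\<^sub>2_def)
      moreover have "z\<^sub>2 (Suc l) = (h + int m) mod N" using 2 by (simp add: z\<^sub>2_def)
      ultimately show ?thesis using refl_h'[of "h + int m"] by simp
    qed
  qed
  moreover have "x \<in> z\<^sub>1 ` {..<m} \<or> x \<in> z\<^sub>2 ` {..<m}"
  proof (cases "x = N")
    case True
    then have "x = z\<^sub>1 0" by (simp add: z\<^sub>1_def)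
    then show ?thesis using m by auto
  next
    case False
    \<comment> \<open>The offset of \<open>x\<close> from \<open>h\<close> locates it: 0 is the last
      point of the second orbit, 1 to \<open>m - 1\<close> lie on the first, larger offsets on the
      second.\<close>
    define e where "e = nat ((x - h) mod N)"
    have e: "int e = (x - h) mod N" using N by (simp add: e_def)
    have "int e < N" unfolding e using N by simp
    then have eN: "e < 2 * m - 1" by (simp add: N_def)
    have xe: "x = (h + int e) mod N" using e False x by (simp add: mod_simps)
    consider "e = 0" | "e > 0" "e < m" | "e \<ge> m" by linarith
    then show ?thesis
    proof cases
      case 1
      have "(h + int m + int (m - 1)) mod N = (h + int e) mod N"
        using m 1 by (intro mod_eqI) (auto simp: N_def)
      then have "x = z\<^sub>2 (m - 1)" using xe m by (simp add: z\<^sub>2_def)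
      then show ?thesis using m by auto
    next
      case 2
      then have "x = z\<^sub>1 e" using xe by (simp add: z\<^sub>1_def)
      then show ?thesis using 2 by auto
    next
      case 3
      then have "x = z\<^sub>2 (e - m)" "e - m < m" using xe eN by (auto simp: z\<^sub>2_def of_nat_diff)
      then show ?thesis by auto
    qed
  qed
  ultimately show ?thesis by blast
qed

section \<open>Reflections inside blocks and shifts between blocks\<close>

text \<open>A point \<open>(r, n)\<close> is position \<open>n\<close> of block \<open>r\<close>,
  with position \<open>k - 1\<close> as infinity. The index \<open>s\<close> is the difference of
  the blocks, so \<open>s = 0\<close> stays inside each block.\<close>

definition shift_or_reflect :: "int \<Rightarrow> int \<Rightarrow> int \<times> int \<Rightarrow> int \<times> int \<Rightarrow> int \<times> int" where
  "shift_or_reflect t k = (\<lambda>(s, c) (r, n).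
     if s = 0 then (r, reflect (k - 1) c n) else ((r + s) mod t, (n + c) mod k))"

text \<open>Two points of one block are joined by a unique reflection, two points of different
  blocks by a unique shift. Orbits are those of \<open>reflect_orbit\<close> for
  \<open>s = 0\<close> and progressions of difference -2 otherwise.\<close>

lemma cyclic_derangements_blocks:
  fixes t m :: nat
  assumes t: "t > 0" and m: "m \<ge> 2"
  defines "T \<equiv> int t" and "K \<equiv> 2 * int m"
  shows "cyclic_derangements ({0..<T} \<times> {0..<K}) ({0} \<times> {0..<K - 1} \<union> {1..<T} \<times> {0..<K})
    (shift_or_reflect T K)
    (\<lambda>(s, c). (s, if s = 0 then (c + int m) mod (K - 1) else (c + 2) mod K)) m"
    (is "cyclic_derangements ?X ?J ?\<rho> ?\<pi> m")
proof -
  have T: "T > 0" and K: "K \<ge> 4" and oddK: "odd (K - 1)" using t m by (auto simp: T_def K_def)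
  have range: "{0..<K} = {0..K - 1}" by auto
  have finX: "finite ?X" and finJ: "finite ?J" by auto
  show ?thesis
  proof
    show "finite ?X" "finite ?J" by (fact finX finJ)+
    show "bij_betw ?\<pi> ?J ?J"
    proof -
      have "inj_on ?\<pi> ?J"
      proof (rule inj_onI)
        fix p q assume pq: "p \<in> ?J" "q \<in> ?J" "?\<pi> p = ?\<pi> q"
        obtain s c s' c' where sc: "p = (s, c)" "q = (s', c')" by (cases p, cases q)
        have "s' = s" using pq(3) sc by simp
        moreover have "c = c'"
        proof (cases "s = 0")
          case True
          then have "(c + int m) mod (K - 1) = (c' + int m) mod (K - 1)" using pq(3) sc by simp
          then show ?thesis by (rule add_mod_cancel) (use pq(1,2) sc True \<open>s' = s\<close> in auto)
        next
          case False
          then have "(c + 2) mod K = (c' + 2) mod K" using pq(3) sc by simp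
          then show ?thesis by (rule add_mod_cancel) (use pq(1,2) sc False \<open>s' = s\<close> in auto)
        qed
        ultimately show "p = q" using sc by simp
      qed
      moreover have "?\<pi> ` ?J \<subseteq> ?J" using K by (auto split: if_splits)
      ultimately show ?thesis using endo_inj_surj[OF finJ] by (simp add: bij_betw_def)
    qed
  next
    fix j assume j: "j \<in> ?J"
    obtain s c where sc: "j = (s, c)" by (cases j)
    show "bij_betw (?\<rho> j) ?X ?X"
    proof (cases "s = 0")
      case True
      with j sc have c: "c \<in> {0..<K - 1}" by auto
      have "?\<rho> j ` ?X \<subseteq> ?X"
        using reflect_in_range[OF c] True unfolding range sc by (auto simp: shift_or_reflect_def)
      moreover have "inj_on (?\<rho> j) ?X"
        using reflect_reflect[OF c] True unfolding range sc
        by (intro inj_on_inverseI[of _ "?\<rho> j"]) (auto simp: shift_or_reflect_def sc)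
      ultimately show ?thesis using endo_inj_surj[OF finX] by (simp add: bij_betw_def)
    next
      case False
      have "?\<rho> j ` ?X \<subseteq> ?X" using False T K sc by (auto simp: shift_or_reflect_def)
      moreover have "inj_on (?\<rho> j) ?X"
      proof (rule inj_onI)
        fix x y assume xy: "x \<in> ?X" "y \<in> ?X" "?\<rho> j x = ?\<rho> j y"
        obtain r n r' n' where rn: "x = (r, n)" "y = (r', n')" by (cases x, cases y)
        have eq: "(r + s) mod T = (r' + s) mod T" "(n + c) mod K = (n' + c) mod K"
          using xy(3) False sc rn by (simp_all add: shift_or_reflect_def)
        have "r = r'" using xy(1,2) rn by (intro add_mod_cancel[OF eq(1)]) auto
        moreover have "n = n'" using xy(1,2) rn by (intro add_mod_cancel[OF eq(2)]) auto
        ultimately show "x = y" using rn by simp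
      qed
      ultimately show ?thesis using endo_inj_surj[OF finX] by (simp add: bij_betw_def)
    qed
  next
    fix j x assume j: "j \<in> ?J" and x: "x \<in> ?X"
    obtain s c r n where sc: "j = (s, c)" and rn: "x = (r, n)" by (cases j, cases x)
    show "?\<rho> j x \<noteq> x"
    proof (cases "s = 0")
      case True
      then show ?thesis using reflect_neq[OF oddK, of c n] j x sc rn by (auto simp: shift_or_reflect_def)
    next
      case False
      then have "\<not> T dvd s" using j sc by (intro not_dvd_if_abs_less) auto
      then have "(r + s) mod T \<noteq> r mod T" by (simp add: mod_eq_dvd_iff)
      then show ?thesis using False x sc rn by (auto simp: shift_or_reflect_def)
    qed
    show "\<exists>z. alternating_orbit ?X (?\<rho> j) (?\<rho> (?\<pi> j)) m z \<and> x \<in> z ` {..<m}"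
    proof (cases "s = 0")
      case True
      have "c \<in> {0..<2 * int m - 1}" "n \<in> {0..2 * int m - 1}"
        using j x sc rn True by (auto simp: K_def)
      from reflect_orbit[OF m this] obtain z where
        z: "alternating_orbit {0..K - 1} (reflect (K - 1) c) (reflect (K - 1) ((c + int m) mod (K - 1))) m z"
        "n \<in> z ` {..<m}" unfolding K_def by blast
      have "alternating_orbit ?X (?\<rho> j) (?\<rho> (?\<pi> j)) m (\<lambda>l. (r, z l))"
        using z(1) x True unfolding alternating_orbit_def range sc rn
        by (auto simp: shift_or_reflect_def inj_on_def)
      moreover have "x \<in> (\<lambda>l. (r, z l)) ` {..<m}" using z(2) rn by auto
      ultimately show ?thesis by blast
    next
      case False
      \<comment> \<open>The shift by \<open>c\<close> followed by the inverse of the shift by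
        \<open>c + 2\<close> subtracts 2 and returns to block \<open>r\<close>; subtracting 2 has
        order \<open>m\<close> modulo \<open>K = 2 * m\<close>.\<close>
      define z where "z l = (r, (n - 2 * int l) mod K)" for l
      have n: "n mod K = n" and r: "r \<in> {0..<T}" using x rn by auto
      have "alternating_orbit ?X (?\<rho> j) (?\<rho> (?\<pi> j)) m z"
        unfolding alternating_orbit_def
      proof (intro conjI allI impI)
        show "inj_on z {..<m}"
        proof (rule inj_onI)
          fix i l assume il: "i \<in> {..<m}" "l \<in> {..<m}" "z i = z l"
          then have "K dvd 2 * (int l - int i)" by (simp add: z_def mod_eq_dvd_iff algebra_simps)
          then have "int m dvd int l - int i" unfolding K_def by (subst (asm) dvd_mult_cancel_left) simp
          then have "int l = int i" using il by (intro dvd_diff_imp_eq) auto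
          then show "i = l" by simp
        qed
        show "z ` {..m} \<subseteq> ?X" using r K by (auto simp: z_def)
        show "z m = z 0" by (simp add: z_def flip: K_def)
        fix l
        have "((n - 2 * int (Suc l)) + (c + 2)) mod K = ((n - 2 * int l) + c) mod K"
          by (simp add: algebra_simps)
        then show "?\<rho> (?\<pi> j) (z (Suc l)) = ?\<rho> j (z l)"
          using False sc by (simp add: z_def shift_or_reflect_def mod_simps)
      qed
      moreover have "x = z 0" using n rn by (simp add: z_def)
      ultimately show ?thesis using m by (intro exI[of _ z]) auto
    qed
  next
    fix x y assume x: "x \<in> ?X" and y: "y \<in> ?X" and "x \<noteq> y"
    obtain r n r' n' where rn: "x = (r, n)" "y = (r', n')" by (cases x, cases y)
    have add_iff: "(v + d) mod q = w \<longleftrightarrow> d = (w - v) mod q"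
      if "w \<in> {0..<q}" "d \<in> {0..<q}" for v w d q :: int
    proof -
      have "(v + d) mod q = w mod q \<longleftrightarrow> d mod q = (w - v) mod q"
        by (simp add: mod_eq_dvd_iff algebra_simps)
      then show ?thesis using that by simp
    qed
    show "\<exists>!j. j \<in> ?J \<and> ?\<rho> j x = y"
    proof (cases "r = r'")
      case True
      then have "n \<noteq> n'" using \<open>x \<noteq> y\<close> rn by auto
      then have "\<exists>!c. c \<in> {0..<K - 1} \<and> reflect (K - 1) c n = n'"
        using x y rn by (intro ex1_reflect[OF oddK]) auto
      then obtain c where c: "c \<in> {0..<K - 1}" "reflect (K - 1) c n = n'"
        "\<And>c'. c' \<in> {0..<K - 1} \<Longrightarrow> reflect (K - 1) c' n = n' \<Longrightarrow> c' = c"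
        by blast
      show ?thesis
      proof (rule ex1I[of _ "(0, c)"])
        show "(0, c) \<in> ?J \<and> ?\<rho> (0, c) x = y" using c(1,2) rn True by (simp add: shift_or_reflect_def)
        fix j assume j: "j \<in> ?J \<and> ?\<rho> j x = y"
        obtain s c' where sc: "j = (s, c')" by (cases j)
        have "s = 0"
        \<comment> \<open>A shift with nonzero \<open>s\<close> changes the block, so it cannot join
          two points of the same block.\<close>
        proof (rule ccontr)
          assume "s \<noteq> 0"
          then have "s \<in> {0..<T}" "(r + s) mod T = r" "r \<in> {0..<T}"
            using j sc rn x True by (auto simp: shift_or_reflect_def)
          with add_iff[of r T s r] \<open>s \<noteq> 0\<close> show False by simp
        qed
        then show "j = (0, c)" using j sc rn c(3)[of c'] by (auto simp: shift_or_reflect_def)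
      qed
    next
      case False
      let ?s = "(r' - r) mod T" and ?c = "(n' - n) mod K"
      have s: "?s \<in> {0..<T}" and c: "?c \<in> {0..<K}" using T K by auto
      have "\<not> T dvd r' - r" using dvd_diff_imp_eq[of T r' r] x y rn False by auto
      then have "?s \<noteq> 0" by (simp add: mod_eq_0_iff_dvd)
      with s have "?s \<in> {1..<T}"
        unfolding atLeastLessThan_iff by linarith
      show ?thesis
      proof (rule ex1I[of _ "(?s, ?c)"])
        have "(?s, ?c) \<in> ?J" using \<open>?s \<in> {1..<T}\<close> c by blast
        moreover have "(r + ?s) mod T = r'" "(n + ?c) mod K = n'"
          using s c rn y add_iff[of r' T ?s r] add_iff[of n' K ?c n] by auto
        ultimately show "(?s, ?c) \<in> ?J \<and> ?\<rho> (?s, ?c) x = y"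
          using \<open>?s \<noteq> 0\<close> rn by (simp add: shift_or_reflect_def)
        fix j assume j: "j \<in> ?J \<and> ?\<rho> j x = y"
        obtain s' c' where sc: "j = (s', c')" by (cases j)
        have "s' \<noteq> 0" using j sc rn False by (auto simp: shift_or_reflect_def)
        then have "s' \<in> {0..<T}" "c' \<in> {0..<K}" "(r + s') mod T = r'" "(n + c') mod K = n'"
          using j sc rn by (auto simp: shift_or_reflect_def)
        then show "j = (?s, ?c)"
          using sc y rn add_iff[of r' T s' r] add_iff[of n' K c' n] by auto
      qed
    qed
  qed
qed

theorem theorem4p3:
  fixes k u g :: nat
  assumes "even k" and "k \<ge> 4"
    and "odd u" and "u \<ge> 3"
    and "g > 0" and "[g = 0] (mod k)"
  shows "\<exists>D. is_ARCS k u g 2 D"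
proof -
  obtain m where k: "k = 2 * m" using \<open>even k\<close> by blast
  obtain t where g: "g = k * t" using \<open>[g = 0] (mod k)\<close> by (auto simp: cong_0_iff)
  have m: "m \<ge> 2" and t: "t > 0" using \<open>k \<ge> 4\<close> \<open>g > 0\<close> k g by auto
  let ?X = "{0..<int t} \<times> {0..<2 * int m}"
  interpret cyclic_derangements ?X
    "{0} \<times> {0..<2 * int m - 1} \<union> {1..<int t} \<times> {0..<2 * int m}"
    "shift_or_reflect (int t) (2 * int m)"
    "\<lambda>(s, c). (s, if s = 0 then (c + int m) mod (2 * int m - 1) else (c + 2) mod (2 * int m))" m
    by (rule cyclic_derangements_blocks[OF t m])
  \<comment> \<open>There are \<open>t\<close> blocks of \<open>k\<close> points, \<open>g\<close>
    in all, and any numbering of them serves for the transport to \<open>{1..g}\<close>.\<close>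
  have "card ?X = card {1..g}" using k g by (simp add: card_cartesian_product nat_mult_distrib)
  then obtain f where "bij_betw f ?X {1..g}"
    using finite_same_card_bij[of ?X "{1..g}"] by auto
  then show ?thesis
    unfolding k using \<open>odd u\<close> m by (intro ARCS_exists) (auto simp: bij_betw_def)
qed

end
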